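(* Let $\mathcal H_B,\mathcal H_A,\mathcal H_E,\mathcal H_X$ be finite-dimensional complex Hilbert spaces (battery, auxiliary, environment, external), let $H_B$ be a Hermitian operator on $\mathcal H_B$, and let $\rho^2_S$ be the density operator on $\mathcal H_B\otimes\mathcal H_A\otimes\mathcal H_E\otimes\mathcal H_X$ describing the state just before the measurement. In each of the following three cases, the average energy $\sum_i s_i(\Psi)$ extracted from the battery over all outcomes of the measurement $\Psi$ is independent of the measurement setting, i.e. it takes the same value for every orthonormal basis $\Psi$ of the measured space $\mathcal K$: (i) POVM on the auxiliary: $\rho^2_S=\rho^2_{BAE}\otimes\rho_X$, $\mathcal K=\mathcal H_A\otimes\mathcal H_X$; (ii) type-1 NPOVM on the auxiliary: $\rho^2_S=\rho^2_{BAE}\otimes\rho_X$, $\mathcal K=\mathcal H_A\otimes\mathcal H_E$; (iii) type-2 NPOVM on the auxiliary: $\rho^2_S=\rho^2_{BAEX}$ not a product with respect to the bipartition $BAE:X$, $\mathcal K=\mathcal H_A\otimes\mathcal H_E\otimes\mathcal H_X$.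
   Context: Let $\rho_B$ be the reduced state of $\rho^2_S$ on $\mathcal H_B$, and let $\sigma$ be the reduced state of $\rho^2_S$ on $\mathcal H_B\otimes\mathcal K$ (so $\sigma=\operatorname{tr}_E(\rho^2_S)$ in case (i), $\sigma=\rho^2_{BAE}$ in case (ii), $\sigma=\rho^2_S$ in case (iii)). A measurement setting is a rank-one projective measurement on $\mathcal K$, i.e. an orthonormal basis $\Psi=\{|\Psi_i\rangle\}_i$ of $\mathcal K$; it induces on the auxiliary $A$ a POVM, a type-1 NPOVM, or a type-2 NPOVM (NPOVM = non-positive operator-valued measurement) in cases (i), (ii), (iii), respectively. For outcome $i$, with unnormalized post-measurement state $\sigma_i=(\mathbb I_B\otimes|\Psi_i\rangle\langle\Psi_i|)\,\sigma\,(\mathbb I_B\otimes|\Psi_i\rangle\langle\Psi_i|)$ and probability $p_i=\operatorname{tr}(\sigma_i)$, the probability-weighted extracted energy is $$s_i(\Psi)=p_i\operatorname{tr}[\rho_BH_B]-\operatorname{tr}\big[H_B\operatorname{tr}_{\mathcal K}(\sigma_i)\big].$$ *)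

theory Defs
  imports "HOL-Analysis.Analysis"
begin

text \<open>
  A finite-dimensional complex Hilbert space with a fixed orthonormal basis indexed by a finite
  type \<open>'n\<close> is \<^typ>\<open>complex ^ 'n\<close>; tensor products of spaces are indexed by products of types.
  The inner product \<open>cinner\<close> is the Hermitian one, antilinear in its first argument; it is not
  the real inner product that the library puts on this type.
\<close>

type_synonym 'n cop = "((complex, 'n) vec, 'n) vec"

definition cinner :: "complex ^ 'n \<Rightarrow> complex ^ 'n \<Rightarrow> complex"
  where "cinner v w = (\<Sum>i\<in>UNIV. cnj (v $ i) * w $ i)"

definition adjoint_op :: "'n::finite cop \<Rightarrow> 'n cop"
  where "adjoint_op M = (\<chi> i j. cnj (M $ j $ i))"

definition hermitian_op :: "'n::finite cop \<Rightarrow> bool"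
  where "hermitian_op M \<longleftrightarrow> adjoint_op M = M"

definition positive_op :: "'n::finite cop \<Rightarrow> bool"
  where "positive_op M \<longleftrightarrow> hermitian_op M \<and> (\<forall>v. 0 \<le> Re (cinner v (M *v v)))"

definition density_op :: "'n::finite cop \<Rightarrow> bool"
  where "density_op M \<longleftrightarrow> positive_op M \<and> trace M = 1"

definition tensor_op :: "'m::finite cop \<Rightarrow> 'n::finite cop \<Rightarrow> ('m \<times> 'n) cop"
  where "tensor_op M N = (\<chi> p q. M $ fst p $ fst q * N $ snd p $ snd q)"

text \<open>The partial trace over the second tensor factor.\<close>

definition ptrace :: "('m::finite \<times> 'n::finite) cop \<Rightarrow> 'm cop"
  where "ptrace M = (\<chi> i j. \<Sum>k\<in>UNIV. M $ (i, k) $ (j, k))"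

text \<open>
  The total space has index type \<open>'b \<times> 'a \<times> 'e \<times> 'x\<close>, which Isabelle parses as
  \<open>'b \<times> ('a \<times> ('e \<times> 'x))\<close>.  The product of an operator on \<open>BAE\<close> with one on \<open>X\<close>, and the
  partial traces over \<open>E\<close> and over \<open>X\<close>, are therefore written out in coordinates.
\<close>

definition tensor_BAE_X ::
    "('b::finite \<times> 'a::finite \<times> 'e::finite) cop \<Rightarrow> 'x::finite cop \<Rightarrow> ('b \<times> 'a \<times> 'e \<times> 'x) cop"
  where "tensor_BAE_X M N =
    (\<chi> p q. case p of (b, a, e, x) \<Rightarrow> case q of (b', a', e', x') \<Rightarrow>
       M $ (b, a, e) $ (b', a', e') * N $ x $ x')"

definition product_state_BAE_X ::
    "('b::finite \<times> 'a::finite \<times> 'e::finite \<times> 'x::finite) cop \<Rightarrow> bool"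
  where "product_state_BAE_X \<rho> \<longleftrightarrow>
    (\<exists>\<rho>BAE \<rho>X. density_op \<rho>BAE \<and> density_op \<rho>X \<and> \<rho> = tensor_BAE_X \<rho>BAE \<rho>X)"

definition ptrace_E ::
    "('b::finite \<times> 'a::finite \<times> 'e::finite \<times> 'x::finite) cop \<Rightarrow> ('b \<times> 'a \<times> 'x) cop"
  where "ptrace_E M =
    (\<chi> p q. case p of (b, a, x) \<Rightarrow> case q of (b', a', x') \<Rightarrow>
       \<Sum>e\<in>UNIV. M $ (b, a, e, x) $ (b', a', e, x'))"

definition ptrace_X ::
    "('b::finite \<times> 'a::finite \<times> 'e::finite \<times> 'x::finite) cop \<Rightarrow> ('b \<times> 'a \<times> 'e) cop"
  where "ptrace_X M =
    (\<chi> p q. case p of (b, a, e) \<Rightarrow> case q of (b', a', e') \<Rightarrow>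
       \<Sum>x\<in>UNIV. M $ (b, a, e, x) $ (b', a', e', x))"

lemma ptrace_X_tensor_BAE_X:
  assumes "density_op N"
  shows "ptrace_X (tensor_BAE_X M N) = M"
proof -
  have "(\<Sum>x\<in>UNIV. N $ x $ x) = 1"
    using assms by (simp add: density_op_def trace_def)
  then show ?thesis
    by (auto simp: ptrace_X_def tensor_BAE_X_def vec_eq_iff simp flip: sum_distrib_left)
qed

text \<open>
  A measurement setting is an orthonormal basis, taken as a set of vectors; its outcomes are
  labelled by the basis vectors themselves.  \<^const>\<open>vec.span\<close> is the span over the complex
  scalars.
\<close>

definition orthonormal_basis :: "(complex ^ 'n) set \<Rightarrow> bool"
  where "orthonormal_basis \<Psi> \<longleftrightarrow>
    (\<forall>\<psi>\<in>\<Psi>. \<forall>\<phi>\<in>\<Psi>. cinner \<psi> \<phi> = (if \<psi> = \<phi> then 1 else 0)) \<and> vec.span \<Psi> = UNIV"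

definition ket_bra :: "complex ^ 'n \<Rightarrow> 'n::finite cop"
  where "ket_bra \<psi> = (\<chi> i j. \<psi> $ i * cnj (\<psi> $ j))"

definition post_measurement ::
    "('b::finite \<times> 'k::finite) cop \<Rightarrow> complex ^ 'k \<Rightarrow> ('b \<times> 'k) cop"
  where "post_measurement \<sigma> \<psi> =
    tensor_op (mat 1) (ket_bra \<psi>) ** \<sigma> ** tensor_op (mat 1) (ket_bra \<psi>)"

definition outcome_prob :: "('b::finite \<times> 'k::finite) cop \<Rightarrow> complex ^ 'k \<Rightarrow> complex"
  where "outcome_prob \<sigma> \<psi> = trace (post_measurement \<sigma> \<psi>)"

definition weighted_energy ::
    "'b::finite cop \<Rightarrow> 'b cop \<Rightarrow> ('b \<times> 'k::finite) cop \<Rightarrow> complex ^ 'k \<Rightarrow> complex"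
  where "weighted_energy HB \<rho>B \<sigma> \<psi> =
    outcome_prob \<sigma> \<psi> * trace (\<rho>B ** HB) - trace (HB ** ptrace (post_measurement \<sigma> \<psi>))"

definition average_energy ::
    "'b::finite cop \<Rightarrow> 'b cop \<Rightarrow> ('b \<times> 'k::finite) cop \<Rightarrow> (complex ^ 'k) set \<Rightarrow> complex"
  where "average_energy HB \<rho>B \<sigma> \<Psi> = (\<Sum>\<psi>\<in>\<Psi>. weighted_energy HB \<rho>B \<sigma> \<psi>)"

end

theory Submission
  imports Defs
begin

text \<open>
  Cyclicity of the partial trace in its second factor reduces the state left on the battery by the
  outcome \<open>\<psi>\<close> to the partial trace of \<open>\<sigma> ** tensor_op (mat 1) (ket_bra \<psi>)\<close>, which is linear in
  \<open>ket_bra \<psi>\<close>.  Since the projections of an orthonormal basis sum to the identity, the average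
  energy depends only on \<open>\<sigma>\<close>.
\<close>

lemma cinner_add_right: "cinner u (v + w) = cinner u v + cinner u w"
  by (simp add: cinner_def algebra_simps sum.distrib)

lemma cinner_scale_right: "cinner u (c *s v) = c * cinner u v"
  by (simp add: cinner_def algebra_simps sum_distrib_left)

lemma ket_bra_mult_vec: "ket_bra \<psi> *v v = cinner \<psi> v *s \<psi>"
  by (simp add: ket_bra_def cinner_def matrix_vector_mult_def vec_eq_iff sum_distrib_left
      sum_distrib_right algebra_simps)

lemma ket_bra_idem:
  assumes "cinner \<psi> \<psi> = 1"
  shows "ket_bra \<psi> ** ket_bra \<psi> = ket_bra \<psi>"
  by (simp add: matrix_eq matrix_vector_mul_assoc[symmetric] ket_bra_mult_vec
      cinner_scale_right assms)

lemma cinner_orthonormal_basis: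
  assumes "orthonormal_basis \<Psi>" "\<psi> \<in> \<Psi>" "\<phi> \<in> \<Psi>"
  shows "cinner \<psi> \<phi> = (if \<psi> = \<phi> then 1 else 0)"
  using assms by (auto simp: orthonormal_basis_def)

text \<open>A basis vector is orthogonal to the span of the others but not to itself, so
  \<open>\<Psi>\<close> is independent, hence finite in finite dimension. Finiteness matters because
  a sum over an infinite set is 0 by convention.\<close>

lemma finite_orthonormal_basis:
  fixes \<Psi> :: "(complex ^ 'n::finite) set"
  assumes "orthonormal_basis \<Psi>"
  shows "finite \<Psi>"
proof -
  have "\<psi> \<notin> vec.span (\<Psi> - {\<psi>})" if "\<psi> \<in> \<Psi>" for \<psi>
  proof -
    have "cinner \<psi> v = 0" if "v \<in> vec.span (\<Psi> - {\<psi>})" for v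
      using that
    proof (induction rule: vec.span_induct_alt)
      case base
      then show ?case by (simp add: cinner_def)
    next
      case (step c x y)
      then show ?case
        using cinner_orthonormal_basis[OF assms \<open>\<psi> \<in> \<Psi>\<close>, of x]
        by (auto simp: cinner_add_right cinner_scale_right)
    qed
    then show ?thesis
      using cinner_orthonormal_basis[OF assms that that] by force
  qed
  then have "vec.independent \<Psi>"
    by (auto simp: vec.dependent_def)
  then show ?thesis
    by (rule vec.finiteI_independent)
qed

lemma matrix_vector_mult_sum_left:
  fixes A :: "'i \<Rightarrow> 'n::finite cop"
  shows "(\<Sum>i\<in>I. A i) *v v = (\<Sum>i\<in>I. A i *v v)"
  by (induction I rule: infinite_finite_induct) (simp_all add: matrix_vector_mult_add_rdistrib)

text \<open>By orthonormality \<open>?P\<close> fixes every basis vector; being linear, it fixes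
  their span, which is the whole space.\<close>

lemma orthonormal_basis_completeness:
  fixes \<Psi> :: "(complex ^ 'n::finite) set"
  assumes "orthonormal_basis \<Psi>"
  shows "(\<Sum>\<psi>\<in>\<Psi>. ket_bra \<psi>) = mat 1"
proof -
  let ?P = "\<Sum>\<psi>\<in>\<Psi>. ket_bra \<psi>"
  note fin = finite_orthonormal_basis[OF assms]
  have basis: "?P *v \<phi> = \<phi>" if "\<phi> \<in> \<Psi>" for \<phi>
  proof -
    have "?P *v \<phi> = (\<Sum>\<psi>\<in>\<Psi>. if \<psi> = \<phi> then \<phi> else 0)"
      unfolding matrix_vector_mult_sum_left ket_bra_mult_vec
      by (rule sum.cong) (auto simp: cinner_orthonormal_basis[OF assms _ that])
    also have "\<dots> = \<phi>"
      using fin that by simp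
    finally show ?thesis .
  qed
  have "?P *v v = v" for v
  proof -
    have "v \<in> vec.span \<Psi>"
      using assms by (simp add: orthonormal_basis_def)
    then show ?thesis
      by (induction rule: vec.span_induct_alt)
        (simp_all add: basis matrix_vector_right_distrib vector_scalar_commute)
  qed
  then show ?thesis
    by (simp add: matrix_eq)
qed

lemma sum_prod_UNIV:
  "(\<Sum>p\<in>UNIV. f p) = (\<Sum>i\<in>UNIV. \<Sum>j\<in>UNIV. f (i :: 'i::finite, j :: 'j::finite))"
  by (simp add: sum.cartesian_product UNIV_Times_UNIV[symmetric] del: UNIV_Times_UNIV)

lemma tensor_one_mult_left:
  "(tensor_op (mat 1) P ** M) $ (b, k) $ q = (\<Sum>l\<in>UNIV. P $ k $ l * M $ (b, l) $ q)"
proof -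
  have "(tensor_op (mat 1) P ** M) $ (b, k) $ q =
      (\<Sum>c\<in>UNIV. \<Sum>l\<in>UNIV. if b = c then P $ k $ l * M $ (c, l) $ q else 0)"
    unfolding matrix_matrix_mult_def tensor_op_def mat_def vec_lambda_beta sum_prod_UNIV
    by (intro sum.cong) auto
  also have "\<dots> = (\<Sum>l\<in>UNIV. P $ k $ l * M $ (b, l) $ q)"
    \<comment> \<open>With the sum over the battery index \<open>c\<close> innermost, the Kronecker
      delta of \<open>mat 1\<close> collapses it.\<close>
    by (subst sum.swap) simp
  finally show ?thesis .
qed

lemma tensor_one_mult_right:
  "(M ** tensor_op (mat 1) P) $ p $ (b, k) = (\<Sum>l\<in>UNIV. M $ p $ (b, l) * P $ l $ k)"
proof -
  have "(M ** tensor_op (mat 1) P) $ p $ (b, k) =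
      (\<Sum>c\<in>UNIV. \<Sum>l\<in>UNIV. if c = b then M $ p $ (c, l) * P $ l $ k else 0)"
    unfolding matrix_matrix_mult_def tensor_op_def mat_def vec_lambda_beta sum_prod_UNIV
    by (intro sum.cong) auto
  also have "\<dots> = (\<Sum>l\<in>UNIV. M $ p $ (b, l) * P $ l $ k)"
    by (subst sum.swap) simp
  finally show ?thesis .
qed

lemma tensor_one_mult_tensor_one:
  "tensor_op (mat 1) P ** tensor_op (mat 1) Q = tensor_op (mat 1) (P ** Q)"
  by (auto simp: vec_eq_iff tensor_one_mult_left)
    (simp add: tensor_op_def matrix_matrix_mult_def sum_distrib_left mult.left_commute)

text \<open>The factor \<open>P\<close> acts only on the space that is traced out, so the battery
  indices stay fixed and exchanging the two sums over that space suffices.\<close>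

lemma ptrace_cyclic:
  "ptrace (tensor_op (mat 1) P ** M) = ptrace (M ** tensor_op (mat 1) P)"
  unfolding ptrace_def tensor_one_mult_left tensor_one_mult_right
  by (subst sum.swap) (simp add: mult.commute)

lemma trace_ptrace: "trace (ptrace M) = trace M"
  by (simp add: trace_def ptrace_def sum_prod_UNIV)

lemma ptrace_post_measurement:
  assumes "cinner \<psi> \<psi> = 1"
  shows "ptrace (post_measurement \<sigma> \<psi>) = ptrace (\<sigma> ** tensor_op (mat 1) (ket_bra \<psi>))"
  \<comment> \<open>Reassociation exposes the left projector as the outer factor; cyclicity carries
    it next to the right one, and idempotence merges the two.\<close>
  unfolding post_measurement_def matrix_mul_assoc[symmetric] ptrace_cyclic
  by (simp add: matrix_mul_assoc[symmetric] tensor_one_mult_tensor_one ket_bra_idem assms)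

lemma sum_ptrace_tensor_one:
  "(\<Sum>i\<in>I. ptrace (\<sigma> ** tensor_op (mat 1) (P i))) = ptrace (\<sigma> ** tensor_op (mat 1) (\<Sum>i\<in>I. P i))"
proof (induction I rule: infinite_finite_induct)
  case (insert i I)
  then show ?case
    by (simp add: vec_eq_iff ptrace_def tensor_one_mult_right algebra_simps sum.distrib)
qed (simp_all add: vec_eq_iff ptrace_def tensor_one_mult_right)

text \<open>This is no-signalling: a measurement on the second factor, averaged over its outcomes,
  leaves the reduced state of the battery unchanged.\<close>

lemma sum_ptrace_post_measurement:
  assumes "orthonormal_basis \<Psi>"
  shows "(\<Sum>\<psi>\<in>\<Psi>. ptrace (post_measurement \<sigma> \<psi>)) = ptrace \<sigma>"
proof -
  have "(\<Sum>\<psi>\<in>\<Psi>. ptrace (post_measurement \<sigma> \<psi>)) =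
      (\<Sum>\<psi>\<in>\<Psi>. ptrace (\<sigma> ** tensor_op (mat 1) (ket_bra \<psi>)))"
    by (intro sum.cong refl ptrace_post_measurement)
      (simp add: cinner_orthonormal_basis[OF assms])
  also have "\<dots> = ptrace (\<sigma> ** tensor_op (mat 1) (mat 1))"
    by (simp add: sum_ptrace_tensor_one orthonormal_basis_completeness[OF assms])
  also have "\<dots> = ptrace \<sigma>"
    by (simp add: vec_eq_iff ptrace_def tensor_one_mult_right)
      (simp add: mat_def if_distrib cong: if_cong)
  finally show ?thesis .
qed

lemma trace_mult_sum:
  fixes A :: "'i \<Rightarrow> 'n::finite cop"
  shows "(\<Sum>i\<in>I. trace (H ** A i)) = trace (H ** (\<Sum>i\<in>I. A i))"
proof (induction I rule: infinite_finite_induct)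
  case (insert i I)
  then show ?case
    by (simp add: matrix_add_ldistrib trace_add)
qed (simp_all add: trace_def)

lemma average_energy_eq:
  assumes "orthonormal_basis \<Psi>"
  shows "average_energy HB \<rho>B \<sigma> \<Psi> = trace \<sigma> * trace (\<rho>B ** HB) - trace (HB ** ptrace \<sigma>)"
proof -
  have "(\<Sum>\<psi>\<in>\<Psi>. outcome_prob \<sigma> \<psi>) = trace \<sigma>"
    \<comment> \<open>Taking \<open>H\<close> to be the identity turns the identity for energies
      into one for probabilities, as \<open>ptrace\<close> preserves the trace.\<close>
    using trace_mult_sum[of "mat 1" "\<lambda>\<psi>. ptrace (post_measurement \<sigma> \<psi>)" \<Psi>]
    by (simp add: outcome_prob_def trace_ptrace sum_ptrace_post_measurement[OF assms])
  then show ?thesis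
    by (simp add: average_energy_def weighted_energy_def sum_subtractf trace_mult_sum
        sum_ptrace_post_measurement[OF assms] flip: sum_distrib_right)
qed

theorem mainTheorem5:
  fixes HB :: "'b::finite cop"
    and \<rho>S :: "('b \<times> 'a::finite \<times> 'e::finite \<times> 'x::finite) cop"
  assumes "hermitian_op HB"
    and "density_op \<rho>S"
  shows
    "(product_state_BAE_X \<rho>S \<longrightarrow>
       (\<forall>(\<Psi> :: (complex ^ ('a \<times> 'x)) set) \<Phi>. orthonormal_basis \<Psi> \<and> orthonormal_basis \<Phi> \<longrightarrow>
          average_energy HB (ptrace \<rho>S) (ptrace_E \<rho>S) \<Psi> =
          average_energy HB (ptrace \<rho>S) (ptrace_E \<rho>S) \<Phi>)) \<and>
     (product_state_BAE_X \<rho>S \<longrightarrow>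
       (\<forall>(\<Psi> :: (complex ^ ('a \<times> 'e)) set) \<Phi>. orthonormal_basis \<Psi> \<and> orthonormal_basis \<Phi> \<longrightarrow>
          average_energy HB (ptrace \<rho>S) (ptrace_X \<rho>S) \<Psi> =
          average_energy HB (ptrace \<rho>S) (ptrace_X \<rho>S) \<Phi>)) \<and>
     (\<not> product_state_BAE_X \<rho>S \<longrightarrow>
       (\<forall>(\<Psi> :: (complex ^ ('a \<times> 'e \<times> 'x)) set) \<Phi>. orthonormal_basis \<Psi> \<and> orthonormal_basis \<Phi> \<longrightarrow>
          average_energy HB (ptrace \<rho>S) \<rho>S \<Psi> =
          average_energy HB (ptrace \<rho>S) \<rho>S \<Phi>))"
  \<comment> \<open>The three cases differ only in \<open>\<sigma>\<close> and the measured space;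
    the closed form of the average does not mention the basis.\<close>
  by (simp add: average_energy_eq)

end
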